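(* Let $a,b,c$ be complex numbers and let $\Psi:\mathbb{Z}\to\mathbb{C}$ be a given function. Consider the linear partial difference equation $$U_{i,j+1}=a\,U_{i-1,j}+b\,U_{i,j}+c\,U_{i+1,j}\qquad (i\in\mathbb{Z},\ j\in\mathbb{N}\cup\{0\})$$ for an unknown function $U:\mathbb{Z}\times(\mathbb{N}\cup\{0\})\to\mathbb{C}$, $(i,j)\mapsto U_{i,j}$, with the initial condition $U_{i,0}=\Psi(i)$ for all $i\in\mathbb{Z}$. Then its solution is given, for all $i\in\mathbb{Z}$ and $j\in\mathbb{N}\cup\{0\}$, by $$U_{i,j}=\sum_{m=0}^{j}\sum_{n=0}^{m}\binom{j}{m}\binom{m}{n}a^{n}b^{m-n}c^{j-m}\,\Psi(i+j-m-n).$$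
   Context: $\mathbb{N}=\{1,2,\dots\}$. The convention $0^0=1$ is used in powers of coefficients. *)

theory Defs
  imports Complex_Main
begin

end

theory Submission
  imports Defs
begin

text \<open>
  Let \<open>S\<close> be the shift \<open>(S \<Phi>) i = \<Phi> (i + 1)\<close>. One time step applies the operator
  \<open>a S\<^sup>-\<^sup>1 + b + c S\<close>, so \<open>U \<sqdot> j = (a S\<^sup>-\<^sup>1 + b + c S)\<^sup>j \<Psi>\<close>. The three summands commute, and expanding
  the power by the binomial theorem, first as \<open>((a S\<^sup>-\<^sup>1 + b) + c S)\<^sup>j\<close> and then inside each
  \<open>(a S\<^sup>-\<^sup>1 + b)\<^sup>m\<close>, gives the double sum; the term with \<open>n\<close> factors \<open>a S\<^sup>-\<^sup>1\<close> and \<open>j - m\<close> factors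
  \<open>c S\<close> evaluates \<open>\<Psi>\<close> at \<open>i - n + (j - m)\<close>.

  Both expansions rest on Pascal's rule for binomial sums (\<open>binomial_sum_Suc\<close>), which shows that the
  inner sums obey the two-term recurrence of \<open>a S\<^sup>-\<^sup>1 + b\<close> and hence the double sum obeys the
  difference equation. The converse is uniqueness: the equation determines time level \<open>j + 1\<close>
  from level \<open>j\<close>.
\<close>

text \<open>
  Pascal's rule in the form of one more factor in a binomial expansion. Here \<open>f p q\<close> stands for the
  contribution of a word with \<open>p\<close> letters of one kind and \<open>q\<close> of the other, and the added letter is
  of either kind. For \<open>f p q = x\<^sup>p y\<^sup>q\<close> this is the induction step of the binomial theorem.
\<close>

lemma binomial_sum_Suc:
  fixes f :: "nat \<Rightarrow> nat \<Rightarrow> 'a::comm_semiring_1"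
  shows "(\<Sum>m\<le>Suc j. of_nat (Suc j choose m) * f m (Suc j - m)) =
         (\<Sum>m\<le>j. of_nat (j choose m) * (f (Suc m) (j - m) + f m (Suc (j - m))))"
proof -
  \<comment> \<open>The term with \<open>m = Suc j\<close> vanishes, so the index can be shifted without a correction at the top.\<close>
  have shift: "(\<Sum>m\<le>j. of_nat (j choose m) * f m (Suc (j - m))) =
      f 0 (Suc j) + (\<Sum>m\<le>j. of_nat (j choose Suc m) * f (Suc m) (j - m))"
  proof -
    have "(\<Sum>m\<le>j. of_nat (j choose m) * f m (Suc (j - m))) =
          (\<Sum>m\<le>Suc j. of_nat (j choose m) * f m (Suc j - m))"
      by (simp add: Suc_diff_le binomial_eq_0)
    also have "\<dots> = f 0 (Suc j) + (\<Sum>m\<le>j. of_nat (j choose Suc m) * f (Suc m) (j - m))"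
      by (subst sum.atMost_Suc_shift) simp
    finally show ?thesis .
  qed
  have "(\<Sum>m\<le>Suc j. of_nat (Suc j choose m) * f m (Suc j - m)) =
        f 0 (Suc j) + (\<Sum>m\<le>j. of_nat (Suc j choose Suc m) * f (Suc m) (j - m))"
    by (subst sum.atMost_Suc_shift) simp
  also have "\<dots> = (\<Sum>m\<le>j. of_nat (j choose m) * f (Suc m) (j - m)) +
      (f 0 (Suc j) + (\<Sum>m\<le>j. of_nat (j choose Suc m) * f (Suc m) (j - m)))"
    by (simp add: distrib_right sum.distrib add_ac)
  also have "\<dots> = (\<Sum>m\<le>j. of_nat (j choose m) * (f (Suc m) (j - m) + f m (Suc (j - m))))"
    unfolding shift [symmetric] by (simp add: distrib_left sum.distrib)
  finally show ?thesis .
qed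

text \<open>The operator power \<open>(a S\<^sup>-\<^sup>1 + b)\<^sup>m\<close> applied to \<open>\<Psi>\<close> and evaluated at \<open>k\<close>.\<close>

definition two_point_power ::
    "'a::comm_semiring_1 \<Rightarrow> 'a \<Rightarrow> (int \<Rightarrow> 'a) \<Rightarrow> nat \<Rightarrow> int \<Rightarrow> 'a" where
  "two_point_power a b \<Psi> m k =
     (\<Sum>n\<le>m. of_nat (m choose n) * (a ^ n * b ^ (m - n) * \<Psi> (k - int n)))"

lemma two_point_power_Suc:
  "two_point_power a b \<Psi> (Suc m) k =
     a * two_point_power a b \<Psi> m (k - 1) + b * two_point_power a b \<Psi> m k"
proof -
  have "two_point_power a b \<Psi> (Suc m) k =
      (\<Sum>n\<le>m. of_nat (m choose n) *
         (a ^ Suc n * b ^ (m - n) * \<Psi> (k - int (Suc n)) +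
          a ^ n * b ^ Suc (m - n) * \<Psi> (k - int n)))"
    unfolding two_point_power_def
    by (rule binomial_sum_Suc [where f = "\<lambda>p q. a ^ p * b ^ q * \<Psi> (k - int p)"])
  also have "\<dots> = a * two_point_power a b \<Psi> m (k - 1) + b * two_point_power a b \<Psi> m k"
    unfolding two_point_power_def sum_distrib_left sum.distrib [symmetric]
    by (intro sum.cong) (simp_all add: algebra_simps)
  finally show ?thesis .
qed

text \<open>The operator power \<open>((a S\<^sup>-\<^sup>1 + b) + c S)\<^sup>j\<close> applied to \<open>\<Psi>\<close> and evaluated at \<open>i\<close>.\<close>

definition three_point_power ::
    "'a::comm_semiring_1 \<Rightarrow> 'a \<Rightarrow> 'a \<Rightarrow> (int \<Rightarrow> 'a) \<Rightarrow> nat \<Rightarrow> int \<Rightarrow> 'a" where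
  "three_point_power a b c \<Psi> j i =
     (\<Sum>m\<le>j. of_nat (j choose m) * (c ^ (j - m) * two_point_power a b \<Psi> m (i + int (j - m))))"

lemma three_point_power_0 [simp]: "three_point_power a b c \<Psi> 0 i = \<Psi> i"
  by (simp add: three_point_power_def two_point_power_def)

lemma three_point_power_Suc:
  "three_point_power a b c \<Psi> (Suc j) i =
     a * three_point_power a b c \<Psi> j (i - 1) + b * three_point_power a b c \<Psi> j i +
     c * three_point_power a b c \<Psi> j (i + 1)"
proof -
  have "three_point_power a b c \<Psi> (Suc j) i =
      (\<Sum>m\<le>j. of_nat (j choose m) *
         (c ^ (j - m) * two_point_power a b \<Psi> (Suc m) (i + int (j - m)) +
          c ^ Suc (j - m) * two_point_power a b \<Psi> m (i + int (Suc (j - m)))))"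
    unfolding three_point_power_def
    by (rule binomial_sum_Suc
          [where f = "\<lambda>p q. c ^ q * two_point_power a b \<Psi> p (i + int q)"])
  also have "\<dots> = a * three_point_power a b c \<Psi> j (i - 1) + b * three_point_power a b c \<Psi> j i +
      c * three_point_power a b c \<Psi> j (i + 1)"
    unfolding three_point_power_def sum_distrib_left sum.distrib [symmetric]
    by (intro sum.cong) (simp_all add: two_point_power_Suc algebra_simps)
  finally show ?thesis .
qed

lemma three_point_power_eq_double_sum:
  "three_point_power a b c \<Psi> j i =
     (\<Sum>m=0..j. \<Sum>n=0..m.
        of_nat (j choose m) * of_nat (m choose n) * a ^ n * b ^ (m - n) * c ^ (j - m) *
        \<Psi> (i + int j - int m - int n))"
  unfolding three_point_power_def two_point_power_def sum_distrib_left atLeast0AtMost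
  by (intro sum.cong) (simp_all add: of_nat_diff ac_simps add_diff_eq)

theorem theorem2p1:
  fixes a b c :: complex
    and \<Psi> :: "int \<Rightarrow> complex"
    and U :: "int \<Rightarrow> nat \<Rightarrow> complex"
  shows "((\<forall>i j. U i (j + 1) = a * U (i - 1) j + b * U i j + c * U (i + 1) j) \<and>
          (\<forall>i. U i 0 = \<Psi> i)) \<longleftrightarrow>
         (\<forall>i j. U i j =
            (\<Sum>m=0..j. \<Sum>n=0..m.
               of_nat (j choose m) * of_nat (m choose n) *
               a ^ n * b ^ (m - n) * c ^ (j - m) *
               \<Psi> (i + int j - int m - int n)))"
  unfolding three_point_power_eq_double_sum [symmetric]
proof
  assume U: "(\<forall>i j. U i (j + 1) = a * U (i - 1) j + b * U i j + c * U (i + 1) j) \<and>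
             (\<forall>i. U i 0 = \<Psi> i)"
  have "U i j = three_point_power a b c \<Psi> j i" for i j
    using U by (induction j arbitrary: i) (simp_all add: three_point_power_Suc)
  then show "\<forall>i j. U i j = three_point_power a b c \<Psi> j i"
    by blast
next
  assume "\<forall>i j. U i j = three_point_power a b c \<Psi> j i"
  then show "(\<forall>i j. U i (j + 1) = a * U (i - 1) j + b * U i j + c * U (i + 1) j) \<and>
             (\<forall>i. U i 0 = \<Psi> i)"
    by (simp add: three_point_power_Suc)
qed

end
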